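(* Let $m\ge 2$ be an integer, let $\{a_1,\ldots,a_{m-1}\}$ be a $3$-distributable multiset of positive integers, and let $S=\sum_{i=1}^{m-1}a_i$. If $c$ is an integer with $S-1<c<S(S-1)$ and $cS$ is even, then $$\mathrm{Rad}_2(a_1,\ldots,a_{m-1},-1;c)\le S+1.$$
   Context: For nonzero integers $b_1,\ldots,b_m$, an integer $c$ and an integer $r\ge 2$, the Rado number $\mathrm{Rad}_r(b_1,\ldots,b_m;c)$ is the least positive integer $N$ such that for every colouring $\chi:\{1,\ldots,N\}\to\{1,\ldots,r\}$ there exist $x_1,\ldots,x_m\in\{1,\ldots,N\}$ (not necessarily distinct) with $\sum_{i=1}^m b_ix_i=c$ and $\chi(x_1)=\cdots=\chi(x_m)$. Thus $\mathrm{Rad}_2(a_1,\ldots,a_{m-1},-1;c)$ refers to the equation $\sum_{i=1}^{m-1}a_ix_i-x_m=c$. An upper bound by a finite number includes the assertion that the Rado number exists. A multiset $\{a_1,\ldots,a_k\}$ of positive integers is $t$-distributable ($t$ a positive integer) if for every choice of nonnegative integers $\sigma_1,\ldots,\sigma_t$ with $\sum_{j=1}^t\sigma_j=\sum_{i=1}^k a_i$ there is a partition of the index set $\{1,\ldots,k\}$ into pairwise disjoint sets $S_1,\ldots,S_t$ (some possibly empty) such that $\sum_{i\in S_j}a_i=\sigma_j$ for every $j\in\{1,\ldots,t\}$. *)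

theory Defs
  imports Main "HOL-Library.Extended_Nat" "HOL-Library.FuncSet" "HOL-Library.Disjoint_Sets"
begin

definition mono_solution :: "nat \<Rightarrow> (nat \<Rightarrow> int) \<Rightarrow> int \<Rightarrow> nat \<Rightarrow> (nat \<Rightarrow> nat) \<Rightarrow> bool" where
  "mono_solution m b c N \<chi> \<longleftrightarrow>
     (\<exists>x :: nat \<Rightarrow> nat. (\<forall>i\<in>{1..m}. x i \<in> {1..N}) \<and>
        (\<Sum>i=1..m. b i * int (x i)) = c \<and>
        (\<forall>i\<in>{1..m}. \<forall>j\<in>{1..m}. \<chi> (x i) = \<chi> (x j)))"

text \<open>
  The Rado number of \<open>b 1 * x 1 + \<dots> + b m * x m = c\<close> for \<open>r\<close> colours. It is the
  least \<open>N\<close> as described below, and \<open>\<infinity>\<close> (the infimum of the empty set) if there is none,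
  so that a finite upper bound includes existence.
\<close>

definition Rado :: "nat \<Rightarrow> nat \<Rightarrow> (nat \<Rightarrow> int) \<Rightarrow> int \<Rightarrow> enat" where
  "Rado r m b c =
     Inf {enat N | N. N \<ge> 1 \<and> (\<forall>\<chi> \<in> {1..N} \<rightarrow> {1..r}. mono_solution m b c N \<chi>)}"

text \<open>
  The multiset \<open>{a 1, \<dots>, a k}\<close> is represented by the family \<open>a\<close> on the index set
  \<open>{1..k}\<close>; positivity of its elements is a separate hypothesis.
\<close>

definition distributable :: "nat \<Rightarrow> nat \<Rightarrow> (nat \<Rightarrow> nat) \<Rightarrow> bool" where
  "distributable t k a \<longleftrightarrow>
     (\<forall>\<sigma> :: nat \<Rightarrow> nat. (\<Sum>j=1..t. \<sigma> j) = (\<Sum>i=1..k. a i) \<longrightarrow>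
        (\<exists>P :: nat \<Rightarrow> nat set. disjoint_family_on P {1..t} \<and> (\<Union>j\<in>{1..t}. P j) = {1..k} \<and>
           (\<forall>j\<in>{1..t}. (\<Sum>i\<in>P j. a i) = \<sigma> j)))"

end

theory Submission
  imports Defs
begin

text \<open>
  Write \<open>c = q (S - 1) + r\<close> with \<open>0 \<le> r < S - 1\<close>. The constant assignment \<open>x = q\<close> would solve the
  equation with right-hand side \<open>c - r\<close>, so the substitution \<open>x = q + z\<close> turns the equation into
  \<open>\<Sum> a\<^sub>i z\<^sub>i - z\<^sub>m = r\<close>, where \<open>z\<close> ranges over a window of \<open>S + 1\<close> consecutive integers that contains
  \<open>0\<close> and \<open>1\<close>. Distributability reduces the left-hand side to what three colour-mates \<open>u, v, w\<close> with
  arbitrary nonnegative integer weights of total \<open>S\<close> can produce (\<open>mono_solution_if_weighted\<close>).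

  If \<open>r = 0\<close>, or if \<open>0\<close> and \<open>1\<close> have the same colour, a solution is immediate. Otherwise let \<open>A\<close> be
  the colour class of \<open>0\<close> and \<open>B\<close> that of \<open>1\<close>. The reflection \<open>z \<mapsto> 1 - z\<close> exchanges the two classes
  and replaces \<open>r\<close> by \<open>S - 1 - r\<close>. As \<open>r S\<close> is even, one of \<open>r\<close> and \<open>S - 1 - r\<close> is even, so \<open>r\<close> may
  be assumed even.

  The heart of the matter is \<open>weighted_solution_if_consecutive\<close>: if \<open>-1\<close> has the same colour as
  \<open>0\<close>, there is a solution. By reflection, there is also one if \<open>2\<close> has the same colour as \<open>1\<close>. So
  \<open>2\<close>, if it lies in the window, can be taken to have the colour of \<open>0\<close>, and then \<open>0\<close> and \<open>2\<close> alone
  produce the even number \<open>r\<close>. If \<open>2\<close> lies outside the window, then \<open>-1\<close> and \<open>-r\<close> lie inside it,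
  and these together with \<open>0\<close> and \<open>1\<close> suffice.
\<close>

section \<open>Solutions with three weighted values\<close>

definition weighted_solution :: "int \<Rightarrow> int \<Rightarrow> int set \<Rightarrow> bool" where
  "weighted_solution S r A \<longleftrightarrow>
     (\<exists>u\<in>A. \<exists>v\<in>A. \<exists>w\<in>A. \<exists>y\<in>A. \<exists>i j k. 0 \<le> i \<and> 0 \<le> j \<and> 0 \<le> k \<and> i + j + k = S \<and>
        i * u + j * v + k * w - y = r)"

lemma weighted_solutionI:
  assumes "u \<in> A" "v \<in> A" "w \<in> A" "y \<in> A"
    and "0 \<le> i" "0 \<le> j" "i + j \<le> S"
    and "i * u + j * v + (S - i - j) * w - y = r"
  shows "weighted_solution S r A"
  unfolding weighted_solution_def
  using assms by (intro bexI[of _ u] bexI[of _ v] bexI[of _ w] bexI[of _ y]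
      exI[of _ i] exI[of _ j] exI[of _ "S - i - j"]) auto

text \<open>
  Because the weights of the left-hand side minus that of \<open>y\<close> add up to \<open>S - 1\<close>, reflecting all
  values at \<open>1/2\<close> changes the value \<open>r\<close> of the equation into \<open>S - 1 - r\<close>.
\<close>

lemma weighted_solution_reflect:
  assumes "weighted_solution S (S - 1 - r) ((\<lambda>z. 1 - z) ` A)"
  shows "weighted_solution S r A"
proof -
  obtain u v w y i j k where mem: "u \<in> A" "v \<in> A" "w \<in> A" "y \<in> A"
    and ijk: "0 \<le> i" "0 \<le> j" "0 \<le> k" "i + j + k = S"
    and eq: "i * (1 - u) + j * (1 - v) + k * (1 - w) - (1 - y) = S - 1 - r"
    using assms unfolding weighted_solution_def by blast
  have k: "k = S - i - j" using ijk by simp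
  show ?thesis
  proof (rule weighted_solutionI[OF mem])
    show "i * u + j * v + (S - i - j) * w - y = r"
      using eq unfolding k by (simp add: algebra_simps)
  qed (use ijk in auto)
qed

text \<open>
  The values \<open>p\<close>, \<open>-1\<close> and \<open>0\<close> with total weight \<open>S\<close> reach \<open>r\<close>: overshoot \<open>r\<close> by the next multiple
  of \<open>p\<close> and come back in steps of \<open>1\<close>. The weight needed is about \<open>r / p + p\<close>, which is convex in
  \<open>p\<close> and hence below \<open>S\<close> in the whole range.
\<close>

lemma overshoot_and_return:
  fixes S r p :: int
  assumes "0 < r" "r < S - 1" "0 < p" "p < S"
  obtains i j where "0 \<le> i" "0 \<le> j" "i + j \<le> S" "i * p - j = r"
proof (cases "p dvd r")
  case True
  then obtain d where d: "r = p * d" by (elim dvdE)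
  with assms have "0 < d" by (simp add: zero_less_mult_iff)
  moreover from this have "1 * d \<le> p * d" using assms by (intro mult_right_mono) auto
  with d assms have "d + 0 \<le> S" by linarith
  ultimately show ?thesis using d by (intro that[of d 0]) (auto simp: mult.commute)
next
  case False
  define d e where "d = r div p" and "e = r mod p"
  have r: "r = d * p + e" by (simp add: d_def e_def)
  have "e \<noteq> 0" using False by (auto simp: e_def dvd_eq_mod_eq_0)
  with assms have e: "0 < e" "e < p" unfolding e_def
    by (simp_all add: order_le_neq_trans)
  have d: "0 \<le> d" using assms by (simp add: d_def pos_imp_zdiv_nonneg_iff)
  have "d + p \<le> S"
  proof (cases "d = 0")
    case True
    then show ?thesis using assms by simp
  next
    case False
    with d assms have "0 \<le> (d - 1) * (p - 1)" by simp
    then have "d + p \<le> d * p + 1" by (simp add: algebra_simps)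
    then show ?thesis using r e assms by linarith
  qed
  then show ?thesis using that[of "d + 1" "p - e"] d e r by (simp add: algebra_simps)
qed

section \<open>Two colours on a window around 0 and 1\<close>

text \<open>
  If \<open>A\<close> contains a positive number, overshooting and returning gives a solution in \<open>A\<close>. Otherwise
  all positive numbers of the window belong to \<open>B\<close>. Then either \<open>S - r\<close> is in the window and is the \<open>y\<close> of a
  solution in \<open>B\<close>, or the window extends so far down that it contains \<open>-r\<close>. Since weights on \<open>-1\<close> and
  \<open>0\<close> produce every value in \<open>[-S, 0]\<close>, every number of the window up to \<open>-r\<close> must lie in \<open>B\<close>, and
  these numbers, combined with the positive ones, solve the equation in \<open>B\<close>.
\<close>

lemma weighted_solution_if_consecutive:
  fixes S r l :: int
  assumes r: "0 < r" "r < S - 1" and cover: "{l..l + S} \<subseteq> A \<union> B"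
    and l: "l \<le> -1" "1 \<le> l + S"
    and A: "A \<subseteq> {l..l + S}" "0 \<in> A" "-1 \<in> A" and B: "1 \<in> B"
  shows "weighted_solution S r A \<or> weighted_solution S r B"
proof (cases "\<exists>p\<in>A. 0 < p")
  case True
  then obtain p where p: "p \<in> A" "0 < p" by blast
  then have "p < S" using A(1) l by auto
  then obtain i j where "0 \<le> i" "0 \<le> j" "i + j \<le> S" "i * p - j = r"
    using overshoot_and_return[OF r p(2)] by blast
  then have "weighted_solution S r A"
    by (intro weighted_solutionI[OF p(1) A(3) A(2) A(2)]) auto
  then show ?thesis ..
next
  case False
  then have pos: "z \<in> B" if "0 < z" "z \<le> l + S" for z
  proof -
    have "z \<in> {l..l + S}" using that l by auto
    with cover have "z \<in> A \<union> B" by blast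
    with False that show ?thesis by auto
  qed
  show ?thesis
  proof (cases "S - r \<le> l + S")
    case True
    with pos r have "S - r \<in> B" by auto
    then have "weighted_solution S r B"
      by (intro weighted_solutionI[OF B B B, where i = 0 and j = 0]) (use r in auto)
    then show ?thesis ..
  next
    case long: False
    show ?thesis
    proof (cases "\<exists>z\<in>A. z \<le> -r")
      case True
      then obtain z where z: "z \<in> A" "z \<le> -r" by blast
      have "l \<le> z" using z A(1) by auto
      then have "weighted_solution S r A"
        using z(2) l r
        by (intro weighted_solutionI[OF A(3) A(2) A(2) z(1), where i = "-z - r" and j = 0]) auto
      then show ?thesis ..
    next
      case False
      then have neg: "z \<in> B" if "l \<le> z" "z \<le> -r" for z
      proof -
        have "z \<in> {l..l + S}" using that l r by auto
        with cover have "z \<in> A \<union> B" by blast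
        with False that show ?thesis by auto
      qed
      have "-r \<in> B" using neg long by auto
      have "weighted_solution S r B"
      proof (cases "2 \<le> l + S")
        case True
        then have "2 \<in> B" using pos by auto
        \<comment> \<open>Reflected, the values \<open>-r\<close>, \<open>2\<close>, \<open>1\<close> become \<open>1 + r\<close>, \<open>-1\<close>, \<open>0\<close>, to be combined to
          \<open>S - 1 - r\<close>.\<close>
        obtain i j where ij: "0 \<le> i" "0 \<le> j" "i + j \<le> S" "i * (1 + r) - j = S - 1 - r"
          using overshoot_and_return[of "S - 1 - r" S "1 + r"] r by auto
        show ?thesis
          using ij
          by (intro weighted_solutionI[OF \<open>-r \<in> B\<close> \<open>2 \<in> B\<close> B B, of i j])
             (auto simp: algebra_simps)
      next
        case False
        with l have "l = 1 - S" by simp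
        then have "1 - S \<in> B" using neg r by auto
        then show ?thesis
          using r
          by (intro weighted_solutionI[OF _ B B \<open>-r \<in> B\<close>, of "1 - S" 1 0]) auto
      qed
      then show ?thesis ..
    qed
  qed
qed

lemma weighted_solution_if_even:
  fixes S r l :: int
  assumes r: "0 < r" "r < S - 1" "even r" and AB: "A \<union> B = {l..l + S}"
    and l: "l \<le> 0" "1 \<le> l + S" and A: "0 \<in> A" and B: "1 \<in> B"
  shows "weighted_solution S r A \<or> weighted_solution S r B"
proof (cases "2 \<le> l + S")
  case True
  have "2 \<in> A \<union> B" using AB True l by auto
  then show ?thesis
  proof
    assume "2 \<in> A"
    with r have "weighted_solution S r A"
      by (intro weighted_solutionI[OF _ A A A, of 2 "r div 2" 0]) auto
    then show ?thesis ..
  next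
    assume "2 \<in> B"
    define f where "f = (\<lambda>z::int. 1 - z)"
    have "f ` A \<union> f ` B = f ` {l..l + S}" using AB by blast
    also have "\<dots> = {1 - l - S..1 - l - S + S}"
      by (simp add: f_def)
    finally have cover: "f ` A \<union> f ` B = {1 - l - S..1 - l - S + S}" .
    have "0 \<in> f ` B" "-1 \<in> f ` B" "1 \<in> f ` A"
      using B \<open>2 \<in> B\<close> A by (auto simp: f_def image_iff intro: bexI[of _ "2::int"])
    then have "weighted_solution S (S - 1 - r) (f ` B) \<or> weighted_solution S (S - 1 - r) (f ` A)"
      by (intro weighted_solution_if_consecutive[of _ _ "1 - l - S"]) (use cover r l True in auto)
    then show ?thesis
      unfolding f_def using weighted_solution_reflect by blast
  qed
next
  case False
  with l have l': "l = 1 - S" by simp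
  have "-1 \<in> A \<union> B" "-r \<in> A \<union> B" using AB l' r by auto
  show ?thesis
  proof (cases "-1 \<in> A \<or> -r \<in> A")
    case True
    then show ?thesis
    proof
      assume "-1 \<in> A"
      then show ?thesis
        by (intro weighted_solution_if_consecutive[of _ _ l]) (use AB r l l' A B in auto)
    next
      assume "-r \<in> A"
      then have "weighted_solution S r A"
        using r by (intro weighted_solutionI[OF A A A, where i = 0 and j = 0]) auto
      then show ?thesis ..
    qed
  next
    case False
    then have mem: "-1 \<in> B" "-r \<in> B" using \<open>-1 \<in> A \<union> B\<close> \<open>-r \<in> A \<union> B\<close> by auto
    \<comment> \<open>The values \<open>-1\<close> and \<open>1\<close> produce exactly the numbers in \<open>[-S, S]\<close> of the parity of \<open>S\<close>, and
      \<open>y = -r\<close> requires the sum \<open>0\<close>, while \<open>y = 1\<close> requires the sum \<open>r + 1\<close>.\<close>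
    have "weighted_solution S r B"
    proof (cases "even S")
      case True
      then show ?thesis
        using r by (intro weighted_solutionI[OF mem(1) B B mem(2), of "S div 2" 0]) auto
    next
      case False
      with r have "even (S - 1 - r)" by simp
      then obtain h where "S - 1 - r = 2 * h" by (elim evenE)
      then show ?thesis
        using r by (intro weighted_solutionI[OF mem(1) B B B, of h 0]) auto
    qed
    then show ?thesis ..
  qed
qed

lemma weighted_solution_two_classes:
  fixes S r l :: int
  assumes r: "0 < r" "r < S - 1" "even (r * S)" and AB: "A \<union> B = {l..l + S}"
    and l: "l \<le> 0" "1 \<le> l + S" and A: "0 \<in> A" and B: "1 \<in> B"
  shows "weighted_solution S r A \<or> weighted_solution S r B"
proof (cases "even r")
  case True
  then show ?thesis using weighted_solution_if_even[OF r(1,2) _ AB l A B] by blast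
next
  case False
  then have even: "even (S - 1 - r)" using r by simp
  define f where "f = (\<lambda>z::int. 1 - z)"
  have "f ` B \<union> f ` A = f ` {l..l + S}" using AB by blast
  also have "\<dots> = {1 - l - S..1 - l - S + S}" by (simp add: f_def)
  finally have cover: "f ` B \<union> f ` A = {1 - l - S..1 - l - S + S}" .
  have "0 \<in> f ` B" "1 \<in> f ` A" using A B by (auto simp: f_def image_iff)
  then have "weighted_solution S (S - 1 - r) (f ` B) \<or> weighted_solution S (S - 1 - r) (f ` A)"
    by (intro weighted_solution_if_even[OF _ _ even cover]) (use r l in auto)
  then show ?thesis
    unfolding f_def using weighted_solution_reflect by blast
qed

section \<open>Back to the original equation\<close>

text \<open>
  This is the only place where distributability enters: the index set splits into three parts whose
  coefficients add up to the prescribed weights, and \<open>x\<close> is constant on each part.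
\<close>

lemma mono_solution_if_weighted:
  fixes a :: "nat \<Rightarrow> nat" and \<chi> :: "nat \<Rightarrow> nat"
  assumes m: "1 \<le> m" and dist: "distributable 3 (m - 1) a" and S: "S = (\<Sum>i=1..m - 1. a i)"
    and sol: "weighted_solution (int S) (c - q * (int S - 1)) C"
    and C: "\<And>z. z \<in> C \<Longrightarrow> z + q \<in> {1..int N} \<and> \<chi> (nat (z + q)) = col"
  shows "mono_solution m ((\<lambda>i. int (a i))(m := -1)) c N \<chi>"
proof -
  obtain u v w y i j k where mem: "u \<in> C" "v \<in> C" "w \<in> C" "y \<in> C"
    and ijk: "0 \<le> i" "0 \<le> j" "0 \<le> k" "i + j + k = int S"
    and eq: "i * u + j * v + k * w - y = c - q * (int S - 1)"
    using sol unfolding weighted_solution_def by blast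
  define \<sigma> where "\<sigma> = (\<lambda>n::nat. nat (if n = 1 then i else if n = 2 then j else k))"
  have three: "{1..3::nat} = {1, 2, 3}" by auto
  have "(\<Sum>n=1..3. \<sigma> n) = \<sigma> 1 + \<sigma> 2 + \<sigma> 3" unfolding three by simp
  also have "\<dots> = S" using ijk by (simp add: \<sigma>_def)
  finally have "(\<Sum>n=1..3. \<sigma> n) = S" .
  then obtain P where disj: "disjoint_family_on P {1..3}"
    and un: "(\<Union>n\<in>{1..3::nat}. P n) = {1..m - 1}"
    and sums: "\<And>n. n \<in> {1..3} \<Longrightarrow> (\<Sum>i\<in>P n. a i) = \<sigma> n"
    using dist S unfolding distributable_def by metis
  define x where "x = (\<lambda>n. nat (q + (if n = m then y else if n \<in> P 1 then u
                                     else if n \<in> P 2 then v else w)))"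
  have P: "P 1 \<inter> P 2 = {}" "P 1 \<inter> P 3 = {}" "P 2 \<inter> P 3 = {}"
    using disj by (auto simp: disjoint_family_on_def)
  have un': "{1..m - 1} = P 1 \<union> P 2 \<union> P 3" using un unfolding three by (simp add: Un_assoc)
  have fin: "finite (P 1)" "finite (P 2)" "finite (P 3)"
    using un' by (metis finite_Un finite_atLeastAtMost)+
  have notm: "n \<noteq> m" if "n \<in> P 1 \<union> P 2 \<union> P 3" for n
    using that m unfolding un'[symmetric] by auto
  have rng: "z + q \<ge> 1" if "z \<in> C" for z using C[OF that] by auto
  have part: "(\<Sum>n\<in>P t. int (a n) * int (x n)) = int (\<sigma> t) * (q + z)"
    if "t \<in> {1..3}" "z \<in> C" "\<And>n. n \<in> P t \<Longrightarrow> x n = nat (q + z)" for t z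
  proof -
    have "(\<Sum>n\<in>P t. int (a n) * int (x n)) = (\<Sum>n\<in>P t. int (a n) * (q + z))"
      using that rng[OF that(2)] by (intro sum.cong) auto
    also have "\<dots> = int (\<Sum>n\<in>P t. a n) * (q + z)" by (simp add: sum_distrib_right)
    finally show ?thesis using sums[OF that(1)] by simp
  qed
  let ?b = "(\<lambda>i. int (a i))(m := -1)"
  have "{1..m} = insert m {1..m - 1}" using m by auto
  then have "(\<Sum>n=1..m. ?b n * int (x n)) = - int (x m) + (\<Sum>n=1..m - 1. ?b n * int (x n))"
    using m by simp
  also have "(\<Sum>n=1..m - 1. ?b n * int (x n)) = (\<Sum>n=1..m - 1. int (a n) * int (x n))"
    using m by (intro sum.cong) auto
  also have "\<dots> = (\<Sum>n\<in>P 1. int (a n) * int (x n)) + (\<Sum>n\<in>P 2. int (a n) * int (x n))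
                   + (\<Sum>n\<in>P 3. int (a n) * int (x n))"
    unfolding un' using P fin by (subst sum.union_disjoint; auto)+
  also have "(\<Sum>n\<in>P 1. int (a n) * int (x n)) = int (\<sigma> 1) * (q + u)"
    by (intro part) (use mem notm in \<open>auto simp: x_def\<close>)
  also have "(\<Sum>n\<in>P 2. int (a n) * int (x n)) = int (\<sigma> 2) * (q + v)"
    by (intro part) (use mem notm P in \<open>auto simp: x_def\<close>)
  also have "(\<Sum>n\<in>P 3. int (a n) * int (x n)) = int (\<sigma> 3) * (q + w)"
    by (intro part) (use mem notm P in \<open>auto simp: x_def\<close>)
  also have "int (x m) = q + y" using rng[OF mem(4)] by (simp add: x_def)
  finally have "(\<Sum>n=1..m. ?b n * int (x n)) = i * u + j * v + k * w - y + q * (i + j + k - 1)"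
    using ijk(1-3) by (simp add: \<sigma>_def algebra_simps)
  also have "\<dots> = c" unfolding eq ijk(4) by simp
  finally have total: "(\<Sum>n=1..m. ?b n * int (x n)) = c" .
  have "x n \<in> {1..N} \<and> \<chi> (x n) = col" for n
    using C[OF mem(1)] C[OF mem(2)] C[OF mem(3)] C[OF mem(4)]
    by (auto simp: x_def add.commute)
  then show ?thesis
    unfolding mono_solution_def using total by (intro exI[of _ x]) auto
qed

theorem theorem16:
  fixes m S :: nat and a :: "nat \<Rightarrow> nat" and c :: int
  assumes "m \<ge> 2"
    and "\<And>i. i \<in> {1..m - 1} \<Longrightarrow> a i > 0"
    and "distributable 3 (m - 1) a"
    and "S = (\<Sum>i=1..m - 1. a i)"
    and "int S - 1 < c" and "c < int S * (int S - 1)"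
    and "even (c * int S)"
  shows "Rado 2 m ((\<lambda>i. int (a i))(m := -1)) c \<le> enat (S + 1)"
proof -
  let ?b = "(\<lambda>i. int (a i))(m := -1)"
  define q r where "q = c div (int S - 1)" and "r = c mod (int S - 1)"
  have S: "1 < S"
  proof (rule ccontr)
    assume "\<not> 1 < S"
    then have "S = 0 \<or> S = 1" by auto
    then show False using assms(5,6) by auto
  qed
  have c: "c = q * (int S - 1) + r" unfolding q_def r_def by (rule div_mult_mod_eq[symmetric])
  have r: "0 \<le> r" "r < int S - 1" using S by (simp_all add: r_def)
  have "q * (int S - 1) < int S * (int S - 1)" using assms(6) c r(1) by linarith
  then have "q < int S" using S by (simp add: mult_less_cancel_right)
  moreover have "1 \<le> q"
    unfolding q_def using assms(5) S zdiv_mono1[of "int S - 1" c "int S - 1"] by simp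
  ultimately have q: "1 \<le> q" "q < int S" by auto
  have even: "even (r * int S)"
    using assms(7) unfolding c by auto
  have "mono_solution m ?b c (S + 1) \<chi>" if \<chi>: "\<chi> \<in> {1..S + 1} \<rightarrow> {1..2}" for \<chi>
  proof -
    define C where "C = (\<lambda>col. {z. z + q \<in> {1..int (S + 1)} \<and> \<chi> (nat (z + q)) = col})"
    have reduce: "mono_solution m ?b c (S + 1) \<chi>" if "weighted_solution (int S) r (C col)" for col
    proof (rule mono_solution_if_weighted[OF _ assms(3,4)])
      show "weighted_solution (int S) (c - q * (int S - 1)) (C col)" using that c by simp
    qed (use assms(1) in \<open>auto simp: C_def\<close>)
    define A B where "A = C (\<chi> (nat q))" and "B = C (\<chi> (nat (1 + q)))"
    have A: "0 \<in> A" and B: "1 \<in> B" using q by (auto simp: A_def B_def C_def)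
    show ?thesis
    proof (cases "r = 0 \<or> \<chi> (nat q) = \<chi> (nat (1 + q))")
      case True
      then have "weighted_solution (int S) r A"
      proof
        assume "r = 0"
        then show ?thesis
          by (intro weighted_solutionI[OF A A A A, of 0 0]) auto
      next
        assume "\<chi> (nat q) = \<chi> (nat (1 + q))"
        then have "1 \<in> A" using B by (simp add: A_def B_def)
        then show ?thesis
          using r by (intro weighted_solutionI[OF _ A A A, of 1 r 0]) auto
      qed
      then show ?thesis using reduce by (simp add: A_def)
    next
      case False
      have two: "\<chi> n = 1 \<or> \<chi> n = 2" if "n \<in> {1..S + 1}" for n
        using funcset_mem[OF \<chi> that] by auto
      have "z \<in> A \<union> B" if "z \<in> {1 - q..1 - q + int S}" for z
      proof -
        have "nat (z + q) \<in> {1..S + 1}" "nat q \<in> {1..S + 1}" "nat (1 + q) \<in> {1..S + 1}"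
          using that q by auto
        then have "\<chi> (nat (z + q)) = \<chi> (nat q) \<or> \<chi> (nat (z + q)) = \<chi> (nat (1 + q))"
          using two False by metis
        then show ?thesis using that by (auto simp: A_def B_def C_def)
      qed
      moreover have "A \<union> B \<subseteq> {1 - q..1 - q + int S}"
        by (auto simp: A_def B_def C_def)
      ultimately have AB: "A \<union> B = {1 - q..1 - q + int S}" by blast
      have "weighted_solution (int S) r A \<or> weighted_solution (int S) r B"
        using r q False by (intro weighted_solution_two_classes[OF _ _ even AB _ _ A B]) auto
      then show ?thesis using reduce by (auto simp: A_def B_def)
    qed
  qed
  then show ?thesis
    unfolding Rado_def by (intro Inf_lower) auto
qed

end
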